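(* Let $S_1$ be a numerical semigroup minimally generated by $m_1<\cdots<m_d$ and let $S=\langle qm_1,\ldots,qm_d,p\rangle$ be an extension of $S_1$. Assume that $S_1$ has a non-decreasing Hilbert function. If the Hilbert function of $S$ is decreasing (that is, it is not non-decreasing), then $\mathrm{ord}_{S_1}(p)<q<p$.
   Context: A numerical semigroup $T$ is a submonoid of $(\mathbb{Z}_{\ge 0},+)$ with finite complement; $\langle\cdots\rangle$ denotes the semigroup (with $0$) generated by the listed integers. Let $M=T\setminus\{0\}$, $nM=M+\cdots+M$ ($n$ summands), $0M=T$. For $s\in T$, $\mathrm{ord}_T(s)$ is the maximum $n\ge 0$ with $s\in nM$. The Hilbert function of $T$ is $H(n)=\#(nM\setminus (n+1)M)$ for $n\ge 0$; equivalently, for a field $K$ and $R=K[[t^s: s\in T]]$ with maximal ideal $\mathfrak m$, $H(n)=\lambda(\mathfrak m^n/\mathfrak m^{n+1})$. It is non-decreasing if $H(n)\le H(n+1)$ for all $n\ge 0$. Extension: $S=\langle qm_1,\ldots,qm_d,p\rangle$ is an extension of $S_1=\langle m_1,\ldots,m_d\rangle$ when $q>1$ is an integer, $p\in S_1\setminus\{m_1,\ldots,m_d\}$ and $\gcd(p,q)=1$. *)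

theory Defs
  imports "HOL.Hull"
begin

definition add_submonoid :: "nat set \<Rightarrow> bool" where
  "add_submonoid T \<longleftrightarrow> 0 \<in> T \<and> (\<forall>x\<in>T. \<forall>y\<in>T. x + y \<in> T)"

definition numerical_semigroup :: "nat set \<Rightarrow> bool" where
  "numerical_semigroup T \<longleftrightarrow> add_submonoid T \<and> finite (- T)"

definition semigroup_gen :: "nat set \<Rightarrow> nat set" where
  "semigroup_gen A = add_submonoid hull A"

definition minimally_generated_by :: "nat set \<Rightarrow> nat set \<Rightarrow> bool" where
  "minimally_generated_by T A \<longleftrightarrow>
     semigroup_gen A = T \<and> (\<forall>B. B \<subset> A \<longrightarrow> semigroup_gen B \<noteq> T)"

text \<open>The set $nM$ for $M = T \setminus \{0\}$, with the convention $0M = T$.\<close>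

definition max_ideal_mult :: "nat set \<Rightarrow> nat \<Rightarrow> nat set" where
  "max_ideal_mult T n =
     (if n = 0 then T else {sum_list xs | xs. length xs = n \<and> set xs \<subseteq> T - {0}})"

text \<open>For $s \in T$ the maximum exists: $s \in nM$ with $s > 0$ forces $n \le s$,
  and $0$ lies in $nM$ only for $n = 0$.\<close>

definition semigroup_ord :: "nat set \<Rightarrow> nat \<Rightarrow> nat" where
  "semigroup_ord T s = (GREATEST n. s \<in> max_ideal_mult T n)"

text \<open>When $T$ is a numerical semigroup, every $nM$ is cofinite, so the set counted
  here is finite.\<close>

definition hilbert_fun :: "nat set \<Rightarrow> nat \<Rightarrow> nat" where
  "hilbert_fun T n = card (max_ideal_mult T n - max_ideal_mult T (n + 1))"

definition nondecreasing_hilbert :: "nat set \<Rightarrow> bool" where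
  "nondecreasing_hilbert T \<longleftrightarrow> (\<forall>n. hilbert_fun T n \<le> hilbert_fun T (n + 1))"

text \<open>\<open>is_extension S A q p\<close>: \<open>S\<close> is the extension, with parameters \<open>q\<close> and \<open>p\<close>, of
  the semigroup generated by \<open>A\<close>. The notion depends on the generating set \<open>A\<close>, not
  only on the semigroup.\<close>

definition is_extension :: "nat set \<Rightarrow> nat set \<Rightarrow> nat \<Rightarrow> nat \<Rightarrow> bool" where
  "is_extension S A q p \<longleftrightarrow>
     S = semigroup_gen ((\<lambda>a. q * a) ` A \<union> {p}) \<and>
     q > 1 \<and> p \<in> semigroup_gen A - A \<and> gcd p q = 1"

end

theory Submission
  imports Defs
begin

text \<open>
  The contrapositive is proved: if \<open>q \<le> ord(p)\<close>, or if \<open>p \<le> q\<close>, then the Hilbert function of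
  \<open>S\<close> is non-decreasing.

  For a semigroup generated by a set \<open>A\<close> of positive integers, \<open>nM\<close> consists of the sums of at
  least \<open>n\<close> generators (lemma \<open>max_ideal_mult_semigroup_gen\<close>). Hence an element of \<open>S\<close> lies in
  the \<open>n\<close>-th power of the maximal ideal iff it can be written \<open>q t + j p\<close> with \<open>t\<close> in the
  \<open>(n - j)\<close>-th power for \<open>S\<^sub>1\<close> (lemma \<open>long_sums_extension_iff\<close>). As \<open>p\<close> and \<open>q\<close> are coprime, two
  such expressions of one element differ only by trading \<open>q\<close> copies of the generator \<open>p\<close> for a
  summand \<open>p\<close> of \<open>t\<close> (lemma \<open>extension_representation_unique\<close>), and the two cases are about
  which side of this trade is the longer one.

  If \<open>q \<le> ord(p)\<close>, the trade towards \<open>S\<^sub>1\<close> never shortens a sum, so the representation with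
  \<open>k < q\<close> copies of \<open>p\<close> computes the order: \<open>q s + k p\<close> has order \<open>ord(s) + k\<close>. Therefore
  \<open>H\<^sub>S(n)\<close> is the sum of \<open>H\<^sub>1(n - k)\<close> over \<open>k < q\<close>, \<open>k \<le> n\<close>, and it inherits monotonicity from
  the Hilbert function \<open>H\<^sub>1\<close> of \<open>S\<^sub>1\<close>.

  If \<open>p \<le> q\<close>, adding \<open>p\<close> raises the order of every \<open>x\<close> in \<open>S\<close> by exactly one (lemma
  \<open>long_sums_extension_cancel\<close>), so translation by \<open>p\<close> embeds the elements of order \<open>n\<close> into
  those of order \<open>n + 1\<close>. The point is that \<open>x + p\<close> has a longest expression that uses the
  generator \<open>p\<close>, which can then be cancelled. Indeed, suppose that a longest one has the form
  \<open>q t\<close> with \<open>t\<close> a sum of \<open>n\<close> generators of \<open>S\<^sub>1\<close>. Adding one \<open>p\<close> to an expression of \<open>x\<close>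
  gives another expression of \<open>q t\<close>, and it contains at least \<open>q\<close> copies of \<open>p\<close>; this settles
  \<open>n \<le> q\<close>. If \<open>n > q\<close>, then \<open>n > p\<close>, and among the \<open>n\<close> generators some block of at most \<open>p\<close>
  consecutive ones has a sum \<open>r p\<close> divisible by \<open>p\<close>; trading the block for \<open>r q\<close> copies of the
  generator \<open>p\<close> does not shorten the expression because \<open>p \<le> q\<close>.
\<close>

section \<open>Powers of the maximal ideal in terms of generators\<close>

definition long_sums :: "nat set \<Rightarrow> nat \<Rightarrow> nat set" where
  "long_sums A n = {sum_list xs | xs. set xs \<subseteq> A \<and> n \<le> length xs}"

lemma long_sumsI: "set xs \<subseteq> A \<Longrightarrow> n \<le> length xs \<Longrightarrow> sum_list xs = x \<Longrightarrow> x \<in> long_sums A n"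
  by (auto simp: long_sums_def)

lemma long_sumsE:
  assumes "x \<in> long_sums A n"
  obtains xs where "set xs \<subseteq> A" "n \<le> length xs" "sum_list xs = x"
  using assms by (auto simp: long_sums_def)

lemma long_sums_antimono: "x \<in> long_sums A n \<Longrightarrow> k \<le> n \<Longrightarrow> x \<in> long_sums A k"
  by (auto simp: long_sums_def)

lemma long_sums_add:
  assumes "x \<in> long_sums A a" "y \<in> long_sums A b"
  shows "x + y \<in> long_sums A (a + b)"
proof -
  obtain xs ys where "set xs \<subseteq> A" "a \<le> length xs" "sum_list xs = x"
    "set ys \<subseteq> A" "b \<le> length ys" "sum_list ys = y"
    using assms by (auto elim!: long_sumsE)
  then show ?thesis
    by (intro long_sumsI[of "xs @ ys"]) auto
qed

lemma long_sums_mult: "x \<in> long_sums A a \<Longrightarrow> i * x \<in> long_sums A (i * a)"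
proof (induction i)
  case 0
  show ?case by (rule long_sumsI[of "[]"]) auto
next
  case (Suc i)
  then show ?case using long_sums_add[of x A a "i * x" "i * a"] by simp
qed

lemma generator_in_long_sums: "a \<in> A \<Longrightarrow> a \<in> long_sums A 1"
  by (rule long_sumsI[of "[a]"]) auto

lemma semigroup_gen_eq_long_sums: "semigroup_gen A = long_sums A 0"
  unfolding semigroup_gen_def
proof (rule hull_unique)
  show "A \<subseteq> long_sums A 0"
    using generator_in_long_sums long_sums_antimono by blast
  show "add_submonoid (long_sums A 0)"
    unfolding add_submonoid_def
    using long_sums_add[of _ A 0 _ 0] long_sumsI[of "[]" A 0 0] by auto
  fix T assume T: "A \<subseteq> T" "add_submonoid T"
  have "sum_list xs \<in> T" if "set xs \<subseteq> A" for xs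
    using that T by (induction xs) (auto simp: add_submonoid_def)
  then show "long_sums A 0 \<subseteq> T"
    by (auto elim!: long_sumsE)
qed

text \<open>A nonzero element of the semigroup is a sum of at least one generator, so \<open>n\<close> of them give
  a sum of at least \<open>n\<close> generators; conversely the generators in excess of \<open>n\<close> can be merged into
  one summand.\<close>

lemma max_ideal_mult_semigroup_gen:
  assumes "0 \<notin> A"
  shows "max_ideal_mult (semigroup_gen A) n = long_sums A n"
proof (cases "n = 0")
  case True
  then show ?thesis
    by (simp add: max_ideal_mult_def semigroup_gen_eq_long_sums)
next
  case False
  let ?T = "long_sums A 0"
  have nonzero: "x \<in> long_sums A 1" if x: "x \<in> ?T" "x \<noteq> 0" for x
  proof -
    obtain xs where xs: "set xs \<subseteq> A" "sum_list xs = x"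
      using x by (auto elim!: long_sumsE)
    then have "xs \<noteq> []" using x(2) by auto
    then show ?thesis using xs by (intro long_sumsI[of xs]) (auto simp: Suc_le_eq)
  qed
  have le: "sum_list xs \<in> long_sums A (length xs)" if "set xs \<subseteq> ?T - {0}" for xs
    using that
  proof (induction xs)
    case Nil
    show ?case by (rule long_sumsI[of "[]"]) auto
  next
    case (Cons x xs)
    then show ?case using long_sums_add[of x A 1 "sum_list xs" "length xs"] nonzero by simp
  qed
  have ge: "\<exists>ys. sum_list xs = sum_list ys \<and> length ys = n \<and> set ys \<subseteq> ?T - {0}"
    if xs: "set xs \<subseteq> A" "n \<le> length xs" for xs
  proof (intro exI conjI)
    let ?l = "drop (n - 1) xs"
    let ?ys = "take (n - 1) xs @ [sum_list ?l]"
    show "sum_list xs = sum_list ?ys"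
      using sum_list_append[of "take (n - 1) xs" ?l] by simp
    show "length ?ys = n" using xs(2) False by simp
    have "?l \<noteq> []" using xs(2) False by simp
    moreover have "set ?l \<subseteq> A" using xs(1) set_drop_subset by fastforce
    ultimately have "sum_list ?l \<noteq> 0"
      using assms by (cases ?l) auto
    moreover have "sum_list ?l \<in> ?T"
      using \<open>set ?l \<subseteq> A\<close> by (auto intro: long_sumsI)
    moreover have "set (take (n - 1) xs) \<subseteq> ?T - {0}"
      using xs(1) assms set_take_subset[of "n - 1" xs] generator_in_long_sums[of _ A]
      by (auto intro: long_sums_antimono)
    ultimately show "set ?ys \<subseteq> ?T - {0}" by simp
  qed
  show ?thesis
    using False le ge
    by (auto simp: max_ideal_mult_def semigroup_gen_eq_long_sums elim!: long_sumsE)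
qed

lemma hilbert_fun_semigroup_gen:
  "0 \<notin> A \<Longrightarrow> hilbert_fun (semigroup_gen A) n = card (long_sums A n - long_sums A (n + 1))"
  by (simp add: hilbert_fun_def max_ideal_mult_semigroup_gen)

lemma long_sums_semigroup_ord:
  assumes "0 \<notin> A" "x \<in> semigroup_gen A"
  shows "x \<in> long_sums A (semigroup_ord (semigroup_gen A) x)"
proof -
  \<comment> \<open>Positive generators: a sum is at least its number of summands, so the maximum exists.\<close>
  have "length xs \<le> sum_list xs" if "set xs \<subseteq> A" for xs
    using that
  proof (induction xs)
    case (Cons x xs)
    then have "0 < x" using assms(1) by (cases x) auto
    then show ?case using Cons by simp
  qed simp
  then have bound: "n \<le> x" if "x \<in> long_sums A n" for n
    using that by (auto elim!: long_sumsE intro: order_trans)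
  show ?thesis
    unfolding semigroup_ord_def max_ideal_mult_semigroup_gen[OF assms(1)]
    by (rule GreatestI_nat[where k = 0 and b = x])
      (use assms(2) bound in \<open>auto simp: semigroup_gen_eq_long_sums\<close>)
qed

text \<open>An element of order \<open>n\<close> is a sum of exactly \<open>n\<close> generators, and there are finitely many
  lists of \<open>n\<close> generators.\<close>

lemma finite_order_level:
  assumes "finite A"
  shows "finite (long_sums A n - long_sums A (n + 1))"
proof (rule finite_subset)
  show "finite (sum_list ` {xs. set xs \<subseteq> A \<and> length xs = n})"
    using assms by (simp add: finite_lists_length_eq)
  show "long_sums A n - long_sums A (n + 1) \<subseteq> sum_list ` {xs. set xs \<subseteq> A \<and> length xs = n}"
  proof
    fix x assume x: "x \<in> long_sums A n - long_sums A (n + 1)"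
    then obtain xs where xs: "set xs \<subseteq> A" "n \<le> length xs" "sum_list xs = x"
      by (auto elim: long_sumsE)
    then have "\<not> n + 1 \<le> length xs" using x long_sumsI[of xs A "n + 1" x] by blast
    then show "x \<in> sum_list ` {xs. set xs \<subseteq> A \<and> length xs = n}"
      using xs by (intro image_eqI[of _ _ xs]) auto
  qed
qed

section \<open>Sums of generators of an extension\<close>

abbreviation extension_generators :: "nat set \<Rightarrow> nat \<Rightarrow> nat \<Rightarrow> nat set" where
  "extension_generators A q p \<equiv> (\<lambda>a. q * a) ` A \<union> {p}"

text \<open>Natural subtraction is intended: when \<open>n \<le> j\<close>, the copies of \<open>p\<close> alone are long enough and
  \<open>t\<close> may be any element of the semigroup generated by \<open>A\<close>.\<close>

lemma long_sums_extension_iff: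
  "x \<in> long_sums (extension_generators A q p) n \<longleftrightarrow>
     (\<exists>t j. x = q * t + j * p \<and> t \<in> long_sums A (n - j))"
proof
  have split: "\<exists>as j. set as \<subseteq> A \<and> sum_list xs = q * sum_list as + j * p
      \<and> length xs = length as + j"
    if "set xs \<subseteq> extension_generators A q p" for xs
    using that
  proof (induction xs)
    case Nil
    show ?case by (rule exI[of _ "[]"]) auto
  next
    case (Cons x xs)
    then obtain as j where as: "set as \<subseteq> A" "sum_list xs = q * sum_list as + j * p"
      "length xs = length as + j" by auto
    consider "x = p" | a where "a \<in> A" "x = q * a" using Cons.prems by auto
    then show ?case
    proof cases
      case 1
      then show ?thesis using as by (intro exI[of _ as] exI[of _ "Suc j"]) auto
    next
      case 2
      then show ?thesis using as
        by (intro exI[of _ "a # as"] exI[of _ j]) (auto simp: algebra_simps)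
    qed
  qed
  assume "x \<in> long_sums (extension_generators A q p) n"
  then obtain xs where xs: "set xs \<subseteq> extension_generators A q p" "n \<le> length xs" "sum_list xs = x"
    by (rule long_sumsE)
  obtain as j where "set as \<subseteq> A" "sum_list xs = q * sum_list as + j * p"
    "length xs = length as + j" using split[OF xs(1)] by blast
  then show "\<exists>t j. x = q * t + j * p \<and> t \<in> long_sums A (n - j)"
    using xs by (intro exI[of _ "sum_list as"] exI[of _ j]) (auto intro!: long_sumsI)
next
  assume "\<exists>t j. x = q * t + j * p \<and> t \<in> long_sums A (n - j)"
  then obtain as j where as: "x = q * sum_list as + j * p" "set as \<subseteq> A" "n - j \<le> length as"
    by (auto elim!: long_sumsE)
  then show "x \<in> long_sums (extension_generators A q p) n"
    by (intro long_sumsI[of "map (\<lambda>a. q * a) as @ replicate j p"])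
      (auto simp: sum_list_const_mult sum_list_replicate)
qed

lemma extension_representation_unique:
  fixes p q :: nat
  assumes "coprime p q" "q * s + k * p = q * t + j * p" "k < q"
  obtains i where "j = k + q * i" "s = t + i * p"
proof (cases "k \<le> j")
  case True
  then have eq: "q * s = q * t + (j - k) * p"
    using assms(2) by (simp add: diff_mult_distrib)
  then have "q dvd (j - k) * p"
    by (metis dvd_add_right_iff dvd_triv_left)
  then have "q dvd j - k"
    using assms(1) by (simp add: coprime_commute coprime_dvd_mult_left_iff)
  then obtain i where i: "j - k = q * i" ..
  then have "q * s = q * (t + i * p)" using eq by (simp add: algebra_simps)
  then show ?thesis using that[of i] i True assms(3) by auto
next
  case False
  then have "q * t = q * s + (k - j) * p"
    using assms(2) by (simp add: diff_mult_distrib)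
  then have "q dvd (k - j) * p"
    by (metis dvd_add_right_iff dvd_triv_left)
  then have "q dvd k - j"
    using assms(1) by (simp add: coprime_commute coprime_dvd_mult_left_iff)
  then show ?thesis using False assms(3) by (auto dest: dvd_imp_le)
qed

section \<open>The case where q is at most the order of p\<close>

text \<open>Every expression of \<open>q s + k p\<close> arises from the one displayed by trading \<open>i\<close> summands \<open>p\<close>
  of \<open>s\<close> for \<open>q i\<close> generators \<open>p\<close>. Undoing the trade does not shorten the expression, because
  each \<open>p\<close> is itself a sum of at least \<open>q\<close> elements of \<open>A\<close>.\<close>

lemma long_sums_extension_reduced_iff:
  assumes "coprime p q" "p \<in> long_sums A q" "k < q"
  shows "q * s + k * p \<in> long_sums (extension_generators A q p) n \<longleftrightarrow> s \<in> long_sums A (n - k)"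
proof
  assume "q * s + k * p \<in> long_sums (extension_generators A q p) n"
  then obtain t j where tj: "q * s + k * p = q * t + j * p" "t \<in> long_sums A (n - j)"
    unfolding long_sums_extension_iff by blast
  obtain i where i: "j = k + q * i" "s = t + i * p"
    using extension_representation_unique[OF assms(1) tj(1) assms(3)] .
  have "s \<in> long_sums A (n - j + i * q)"
    unfolding i(2) by (intro long_sums_add long_sums_mult tj(2) assms(2))
  then show "s \<in> long_sums A (n - k)"
    by (rule long_sums_antimono) (simp add: i(1) mult.commute)
next
  assume "s \<in> long_sums A (n - k)"
  then show "q * s + k * p \<in> long_sums (extension_generators A q p) n"
    unfolding long_sums_extension_iff by blast
qed

lemma reduced_representation_exists:
  assumes "p \<in> long_sums A q" "q > 0" "x \<in> long_sums (extension_generators A q p) n"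
  obtains s k where "k < q" "x = q * s + k * p"
proof -
  obtain t j where "x = q * t + j * p"
    using assms(3) unfolding long_sums_extension_iff by blast
  then have "x = q * (t + (j div q) * p) + (j mod q) * p"
    by (metis add.assoc add_mult_distrib add_mult_distrib2 mult.assoc mult_div_mod_eq)
  then show ?thesis using that[of "j mod q"] assms(2) by simp
qed

text \<open>The elements of order \<open>n\<close> are the \<open>q s + k p\<close> with \<open>k < q\<close> and \<open>s\<close> of order \<open>n - k\<close>. The
  summands with \<open>k > n\<close> are cardinalities of empty sets, since both subtractions are then \<open>0\<close>.\<close>

lemma card_order_level_extension:
  assumes "coprime p q" "p \<in> long_sums A q" "q > 0" "finite A"
  defines "B \<equiv> extension_generators A q p"
  shows "card (long_sums B n - long_sums B (n + 1)) =
    (\<Sum>k<q. card (long_sums A (n - k) - long_sums A (n + 1 - k)))"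
proof -
  let ?L = "\<lambda>k. long_sums A (n - k) - long_sums A (n + 1 - k)"
  let ?f = "\<lambda>(k, s). q * s + k * p"
  have fin: "finite (?L k)" for k
    using finite_order_level[OF assms(4), of "n - k"] by (cases "k \<le> n") (auto simp: Suc_diff_le)
  have "inj_on ?f (Sigma {..<q} ?L)"
  proof (rule inj_onI, clarsimp)
    fix k s j t assume kj: "k < q" "j < q" and eq: "q * s + k * p = q * t + j * p"
    obtain i where "j = k + q * i" "s = t + i * p"
      using extension_representation_unique[OF assms(1) eq kj(1)] .
    with kj(2) show "k = j \<and> s = t" by (cases i) auto
  qed
  moreover have "long_sums B n - long_sums B (n + 1) = ?f ` Sigma {..<q} ?L"
  proof (intro equalityI subsetI)
    fix x assume x: "x \<in> long_sums B n - long_sums B (n + 1)"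
    then obtain s k where ks: "k < q" "x = q * s + k * p"
      unfolding B_def using reduced_representation_exists[OF assms(2,3)] by blast
    then have "s \<in> ?L k"
      using x unfolding B_def
      by (simp add: long_sums_extension_reduced_iff[OF assms(1,2)] del: Un_insert_right)
    then show "x \<in> ?f ` Sigma {..<q} ?L"
      using ks by (intro image_eqI[of _ _ "(k, s)"]) auto
  next
    fix x assume "x \<in> ?f ` Sigma {..<q} ?L"
    then obtain k s where "k < q" "x = q * s + k * p" "s \<in> ?L k" by auto
    then show "x \<in> long_sums B n - long_sums B (n + 1)"
      unfolding B_def
      by (simp add: long_sums_extension_reduced_iff[OF assms(1,2)] del: Un_insert_right)
  qed
  ultimately show ?thesis
    using fin by (simp add: card_image card_SigmaI)
qed

lemma nondecreasing_hilbert_extension_if_le_order: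
  assumes "coprime p q" "p \<in> long_sums A q" "q > 0" "p > 0" "finite A" "0 \<notin> A"
    and "nondecreasing_hilbert (semigroup_gen A)"
  shows "nondecreasing_hilbert (semigroup_gen (extension_generators A q p))"
  unfolding nondecreasing_hilbert_def
proof
  fix n
  have nz: "0 \<notin> extension_generators A q p" using assms by auto
  have "card (long_sums A (n - k) - long_sums A (n + 1 - k))
      \<le> card (long_sums A (n + 1 - k) - long_sums A (n + 1 + 1 - k))" for k
  proof (cases "k \<le> n")
    case True
    then show ?thesis
      using assms(7) hilbert_fun_semigroup_gen[OF assms(6)]
      by (auto simp: nondecreasing_hilbert_def Suc_diff_le)
  qed simp
  then show "hilbert_fun (semigroup_gen (extension_generators A q p)) n
      \<le> hilbert_fun (semigroup_gen (extension_generators A q p)) (n + 1)"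
    unfolding hilbert_fun_semigroup_gen[OF nz] card_order_level_extension[OF assms(1-3,5)]
    by (rule sum_mono)
qed

section \<open>The case where p is at most q\<close>

text \<open>Two of the \<open>p + 1\<close> shortest initial segments have sums that agree modulo \<open>p\<close>.\<close>

lemma exists_block_dvd_sum_list:
  fixes xs :: "nat list"
  assumes "0 < p" "p \<le> length xs"
  obtains us vs ws where "xs = us @ vs @ ws" "vs \<noteq> []" "length vs \<le> p" "p dvd sum_list vs"
proof -
  let ?f = "\<lambda>i. sum_list (take i xs) mod p"
  have "card (?f ` {..p}) \<le> card {..<p}"
    using assms(1) by (intro card_mono) auto
  then have "\<not> inj_on ?f {..p}"
    by (intro pigeonhole) simp
  then obtain a b where ab: "a < b" "b \<le> p" "?f a = ?f b"
    unfolding inj_on_def by (metis atMost_iff linorder_neqE_nat)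
  let ?vs = "take (b - a) (drop a xs)"
  have b: "take b xs = take a xs @ ?vs"
    using ab(1) take_add[of a "b - a" xs] by simp
  then have "p dvd sum_list ?vs"
    using ab(3) by (metis add_diff_cancel_left' le_add1 mod_eq_dvd_iff_nat sum_list_append)
  moreover have "xs = take a xs @ ?vs @ drop b xs"
    using b append_take_drop_id[of b xs] by simp
  moreover have "length ?vs = b - a" using ab assms(2) by simp
  then have "?vs \<noteq> []" "length ?vs \<le> p" using ab by auto
  ultimately show ?thesis using that by blast
qed

text \<open>If the given expression of \<open>x + p\<close> contains the generator \<open>p\<close>, remove it. Otherwise it is
  \<open>q t\<close> with \<open>t\<close> a sum of at least \<open>n\<close> elements of \<open>A\<close>, and a different expression of \<open>x + p\<close>,
  long enough and containing \<open>p\<close>, takes its place: for \<open>n \<le> q\<close> the one obtained from any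
  expression of \<open>x\<close>, for \<open>n > q\<close> the one obtained by trading a block with sum divisible by \<open>p\<close>.\<close>

lemma long_sums_extension_cancel:
  assumes "coprime p q" "0 < p" "p \<le> q" "0 \<notin> A"
  defines "B \<equiv> extension_generators A q p"
  assumes x: "x \<in> long_sums B 0" and xp: "x + p \<in> long_sums B n"
  shows "x \<in> long_sums B (n - 1)"
proof -
  obtain t j where tj: "x + p = q * t + j * p" "t \<in> long_sums A (n - j)"
    using xp unfolding B_def long_sums_extension_iff by blast
  show ?thesis
  proof (cases j)
    case (Suc i)
    then have "x = q * t + i * p" "t \<in> long_sums A (n - 1 - i)" using tj by auto
    then show ?thesis unfolding B_def long_sums_extension_iff by blast
  next
    case 0
    obtain s k where sk: "x = q * s + k * p" "s \<in> long_sums A 0"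
      using x unfolding B_def long_sums_extension_iff by auto
    show ?thesis
    proof (cases "n \<le> q")
      case True
      \<comment> \<open>Since \<open>q t = q s + (k + 1) p\<close>, the expression of \<open>x\<close> in \<open>S\<close> uses at least \<open>q - 1\<close>
        copies of \<open>p\<close>, which is already enough.\<close>
      have "q * t + 0 * p = q * s + (k + 1) * p" using tj(1) sk(1) 0 by simp
      moreover have "0 < q" using assms(2,3) by simp
      ultimately obtain i where "k + 1 = 0 + q * i"
        using extension_representation_unique[OF assms(1)] by metis
      then have "q \<le> k + 1" by (cases i) auto
      then have "s \<in> long_sums A (n - 1 - k)" using sk(2) True by simp
      then show ?thesis using sk(1) unfolding B_def long_sums_extension_iff by blast
    next
      case False
      obtain ts where ts: "set ts \<subseteq> A" "n \<le> length ts" "sum_list ts = t"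
        using tj(2) 0 by (auto elim: long_sumsE)
      then have "p \<le> length ts" using False assms(3) by simp
      then obtain us vs ws where split: "ts = us @ vs @ ws" "vs \<noteq> []" "length vs \<le> p"
        "p dvd sum_list vs" using exists_block_dvd_sum_list[OF assms(2)] by blast
      obtain r where r: "sum_list vs = p * r" using split(4) ..
      have "sum_list vs \<noteq> 0"
        using split(1,2) ts(1) assms(4) by (auto simp: neq_Nil_conv)
      then have "0 < r" using r by (cases r) auto
      then have rq: "q \<le> r * q" by simp
      let ?s = "sum_list (us @ ws)"
      have "t = ?s + r * p" using ts(3) split(1) r by (simp add: mult.commute)
      then have "x + p = q * ?s + (r * q) * p"
        using tj(1) 0 by (simp add: algebra_simps)
      moreover have "(r * q) * p = (r * q - 1) * p + p"
        using rq assms(2,3) by (cases "r * q") auto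
      ultimately have "x = q * ?s + (r * q - 1) * p" by simp
      moreover have "?s \<in> long_sums A (n - 1 - (r * q - 1))"
        using ts(1,2) split(1,3) order_trans[OF assms(3) rq]
        by (intro long_sumsI[of "us @ ws"]) auto
      ultimately show ?thesis unfolding B_def long_sums_extension_iff by blast
    qed
  qed
qed

lemma nondecreasing_hilbert_extension_if_le:
  assumes "coprime p q" "0 < p" "p \<le> q" "finite A" "0 \<notin> A"
  shows "nondecreasing_hilbert (semigroup_gen (extension_generators A q p))"
  unfolding nondecreasing_hilbert_def
proof
  fix n
  let ?B = "extension_generators A q p"
  have nz: "0 \<notin> ?B" using assms by auto
  have "(\<lambda>x. x + p) ` (long_sums ?B n - long_sums ?B (n + 1))
      \<subseteq> long_sums ?B (n + 1) - long_sums ?B (n + 1 + 1)"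
  proof (rule image_subsetI)
    fix x assume x: "x \<in> long_sums ?B n - long_sums ?B (n + 1)"
    then have "x + p \<in> long_sums ?B (n + 1)"
      using long_sums_add[of x ?B n p 1] generator_in_long_sums[of p ?B] by auto
    moreover have "x \<in> long_sums ?B 0"
      using x by (auto intro: long_sums_antimono)
    then have "x + p \<notin> long_sums ?B (n + 1 + 1)"
      using x long_sums_extension_cancel[OF assms(1-3,5), of x "n + 1 + 1"] by auto
    ultimately show "x + p \<in> long_sums ?B (n + 1) - long_sums ?B (n + 1 + 1)" by blast
  qed
  then show "hilbert_fun (semigroup_gen ?B) n \<le> hilbert_fun (semigroup_gen ?B) (n + 1)"
    unfolding hilbert_fun_semigroup_gen[OF nz]
    using finite_order_level[of ?B "n + 1"] assms(4)
    by (intro card_inj_on_le[of "\<lambda>x. x + p"]) auto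
qed

section \<open>Extensions with decreasing Hilbert function\<close>

lemma minimally_generated_by_zero_notin:
  assumes "minimally_generated_by T A"
  shows "0 \<notin> A"
proof
  assume "0 \<in> A"
  have "A \<subseteq> semigroup_gen (A - {0})"
    using generator_in_long_sums[of _ "A - {0}"] long_sumsI[of "[]" "A - {0}" 0 0]
    by (fastforce simp: semigroup_gen_eq_long_sums intro: long_sums_antimono)
  moreover have "add_submonoid (semigroup_gen (A - {0}))"
    using long_sums_add[of _ "A - {0}" 0 _ 0] long_sumsI[of "[]" "A - {0}" 0 0]
    by (auto simp: add_submonoid_def semigroup_gen_eq_long_sums)
  ultimately have "semigroup_gen A \<subseteq> semigroup_gen (A - {0})"
    unfolding semigroup_gen_def[of A] by (rule hull_minimal)
  moreover have "semigroup_gen (A - {0}) \<subseteq> semigroup_gen A"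
    unfolding semigroup_gen_def by (rule hull_mono) auto
  ultimately show False
    using assms \<open>0 \<in> A\<close> unfolding minimally_generated_by_def by blast
qed

theorem theorem4p10:
  fixes S1 S :: "nat set" and m :: "nat \<Rightarrow> nat" and d q p :: nat
  assumes "numerical_semigroup S1"
    and "strict_mono_on {1..d} m"
    and "minimally_generated_by S1 (m ` {1..d})"
    and "is_extension S (m ` {1..d}) q p"
    and "nondecreasing_hilbert S1"
    and "\<not> nondecreasing_hilbert S"
  shows "semigroup_ord S1 p < q \<and> q < p"
proof -
  let ?A = "m ` {1..d}"
  have S1: "S1 = semigroup_gen ?A" and nz: "0 \<notin> ?A"
    using assms(3) minimally_generated_by_zero_notin by (auto simp: minimally_generated_by_def)
  have S: "S = semigroup_gen (extension_generators ?A q p)" and q: "q > 1"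
    and p: "p \<in> semigroup_gen ?A" and cop: "coprime p q"
    using assms(4) by (auto simp: is_extension_def coprime_iff_gcd_eq_1)
  have "p > 0" using cop q by (cases "p = 0") auto
  have "semigroup_ord S1 p < q"
  proof (rule ccontr)
    assume "\<not> semigroup_ord S1 p < q"
    then have "p \<in> long_sums ?A q"
      using long_sums_semigroup_ord[OF nz p] S1 by (auto intro: long_sums_antimono)
    then show False
      using nondecreasing_hilbert_extension_if_le_order[OF cop _ _ \<open>p > 0\<close> _ nz] q assms(5,6) S S1
      by auto
  qed
  moreover have "q < p"
    using nondecreasing_hilbert_extension_if_le[OF cop \<open>p > 0\<close> _ _ nz] assms(6) S
    by (meson finite_atLeastAtMost finite_imageI not_less)
  ultimately show ?thesis ..
qed

end
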